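(* Let $\mathcal R_1,\mathcal R_2\subset\mathcal G$ be finite generating sets of $\mathcal G$. Then the seminorms $u\mapsto\|\nabla_{\mathcal R_1}u\|_2$ and $u\mapsto\|\nabla_{\mathcal R_2}u\|_2$ on $U_{\mathrm{per}}$ are equivalent and their kernel is $U_{\mathrm{trans}}\cap U_{\mathrm{per}}$.
   Context: Euclidean group: $\mathrm E(n)$ consists of pairs $(A|b)$, $A\in\mathrm O(n)$, $b\in\mathbb R^n$, acting by $(A|b)\cdot x=Ax+b$, product $(A_1|b_1)(A_2|b_2)=(A_1A_2|b_1+A_1b_2)$; $\mathrm{rot}(A|b)=A$. Standing setting: $d=d_1+d_2$; $\mathcal S<\mathrm E(d_2)$ is a space group with translation subgroup $\mathcal T_{\mathcal S}$; $A\oplus(B|b)=(\mathrm{diag}(A,B)|(0,b))$; $\mathcal G$ is a discrete subgroup of $\mathrm E(d)$ contained in $\{A\oplus s:A\in\mathrm O(d_1),s\in\mathcal S\}$ projecting onto $\mathcal S$; $\mathcal T\subset\mathcal G$ maps bijectively onto $\mathcal T_{\mathcal S}$. There is $m_0\in\mathbb N$ such that $\mathcal T^N=\{t^N:t\in\mathcal T\}$ is a normal subgroup iff $N\in\mathcal M=m_0\mathbb N$, then isomorphic to $\mathbb Z^{d_2}$ of finite index; $\mathcal C_N$ is a fixed set of representatives of $\mathcal G/\mathcal T^N$. $U_{\mathrm{per}}$: maps $u:\mathcal G\to\mathbb R^d$ that are $\mathcal T^N$-periodic ($u(gt)=u(g)$ for $t\in\mathcal T^N$) for some $N\in\mathcal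 M$. For finite $\mathcal R$, $\nabla_{\mathcal R}u(g)\in(\mathbb R^d)^{\mathcal R}$, $\nabla_{\mathcal R}u(g)(h)=u(gh)-\mathrm{rot}(h)^Tu(g)$, and for $\mathcal T^N$-periodic $u$, $\|\nabla_{\mathcal R}u\|_2=\big(\frac1{|\mathcal C_N|}\sum_{g\in\mathcal C_N}\sum_{h\in\mathcal R}|\nabla_{\mathcal R}u(g)(h)|^2\big)^{1/2}$. $U_{\mathrm{trans}}$: maps $u:\mathcal G\to\mathbb R^d$ with some $a\in\mathbb R^d$ such that $\mathrm{rot}(g)u(g)=a$ for all $g\in\mathcal G$. *)

theory Defs
  imports "HOL-Analysis.Analysis"
begin

text \<open>Elements of the Euclidean group E(n) are represented as pairs (A, b) of an
  n x n real matrix and a vector; the index type 'n models {1..d}.\<close>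

type_synonym 'n euc = "(real^'n^'n) \<times> (real^'n)"

definition rot :: "'n::finite euc \<Rightarrow> real^'n^'n" where
  "rot g = fst g"

definition emul :: "'n::finite euc \<Rightarrow> 'n euc \<Rightarrow> 'n euc" where
  "emul g h = (fst g ** fst h, snd g + fst g *v snd h)"

definition eone :: "'n::finite euc" where
  "eone = (mat 1, 0)"

definition einv :: "'n::finite euc \<Rightarrow> 'n euc" where
  "einv g = (transpose (fst g), - (transpose (fst g) *v snd g))"

definition eact :: "'n::finite euc \<Rightarrow> real^'n \<Rightarrow> real^'n" where
  "eact g x = fst g *v x + snd g"

definition in_E :: "'n::finite euc \<Rightarrow> bool" where
  "in_E g \<longleftrightarrow> orthogonal_matrix (fst g)"

fun epow :: "'n::finite euc \<Rightarrow> nat \<Rightarrow> 'n euc" where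
  "epow g 0 = eone"
| "epow g (Suc k) = emul g (epow g k)"

definition euclid_subgroup :: "'n::finite euc set \<Rightarrow> bool" where
  "euclid_subgroup H \<longleftrightarrow> H \<subseteq> {g. in_E g} \<and> eone \<in> H \<and>
     (\<forall>g\<in>H. \<forall>h\<in>H. emul g h \<in> H) \<and> (\<forall>g\<in>H. einv g \<in> H)"

definition discrete_set :: "'n::finite euc set \<Rightarrow> bool" where
  "discrete_set H \<longleftrightarrow> (\<forall>g\<in>H. \<exists>e>0. \<forall>h\<in>H. dist h g < e \<longrightarrow> h = g)"

definition normal_subgroup :: "'n::finite euc set \<Rightarrow> 'n euc set \<Rightarrow> bool" where
  "normal_subgroup H G \<longleftrightarrow> euclid_subgroup H \<and> H \<subseteq> G \<and>
     (\<forall>g\<in>G. \<forall>h\<in>H. emul (emul g h) (einv g) \<in> H)"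

definition generated :: "'n::finite euc set \<Rightarrow> 'n euc set" where
  "generated R = \<Inter>{H. euclid_subgroup H \<and> R \<subseteq> H}"

text \<open>Splitting R^d = R^{d1} x R^{d2}: D2 is the set of indices of the second
  block (d2 = card D2), the complement are the d1 indices of the first block.\<close>

definition block_form :: "'n::finite set \<Rightarrow> 'n euc \<Rightarrow> bool" where
  "block_form D2 g \<longleftrightarrow> in_E g \<and>
     (\<forall>i j. (i \<in> D2 \<longleftrightarrow> j \<notin> D2) \<longrightarrow> fst g $ i $ j = 0) \<and>
     (\<forall>i. i \<notin> D2 \<longrightarrow> snd g $ i = 0)"

text \<open>Projection A \<oplus> s \<mapsto> s, where s \<in> E(d2) is embedded as Id \<oplus> s.\<close>
definition proj :: "'n::finite set \<Rightarrow> 'n euc \<Rightarrow> 'n euc" where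
  "proj D2 g = ((\<chi> i j. if i \<in> D2 \<and> j \<in> D2 then fst g $ i $ j
                          else if i = j then 1 else 0), snd g)"

definition block2 :: "'n::finite set \<Rightarrow> (real^'n) set" where
  "block2 D2 = {x. \<forall>i. i \<notin> D2 \<longrightarrow> x $ i = 0}"

text \<open>Space group in E(d2) (embedded as Id \<oplus> E(d2)): a discrete subgroup with
  compact quotient (cocompact).\<close>
definition space_group :: "'n::finite set \<Rightarrow> 'n euc set \<Rightarrow> bool" where
  "space_group D2 S \<longleftrightarrow> euclid_subgroup S \<and> discrete_set S \<and>
     (\<forall>s\<in>S. block_form D2 s \<and> proj D2 s = s) \<and>
     (\<exists>K. compact K \<and> K \<subseteq> block2 D2 \<and>
          (\<forall>x\<in>block2 D2. \<exists>s\<in>S. \<exists>k\<in>K. x = eact s k))"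

definition trans_sub :: "'n::finite euc set \<Rightarrow> 'n euc set" where
  "trans_sub S = {s \<in> S. fst s = mat 1}"

definition Tpow :: "'n::finite euc set \<Rightarrow> nat \<Rightarrow> 'n euc set" where
  "Tpow T N = (\<lambda>t. epow t N) ` T"

definition Mset :: "'n::finite euc set \<Rightarrow> 'n euc set \<Rightarrow> nat set" where
  "Mset G T = {N. N \<ge> 1 \<and> normal_subgroup (Tpow T N) G}"

definition periodic :: "'n::finite euc set \<Rightarrow> 'n euc set \<Rightarrow> ('n euc \<Rightarrow> real^'n) \<Rightarrow> bool" where
  "periodic G H u \<longleftrightarrow> (\<forall>g\<in>G. \<forall>t\<in>H. u (emul g t) = u g)"

definition U_per :: "'n::finite euc set \<Rightarrow> 'n euc set \<Rightarrow> ('n euc \<Rightarrow> real^'n) set" where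
  "U_per G T = {u. \<exists>N \<in> Mset G T. periodic G (Tpow T N) u}"

definition U_trans :: "'n::finite euc set \<Rightarrow> ('n euc \<Rightarrow> real^'n) set" where
  "U_trans G = {u. \<exists>a. \<forall>g\<in>G. rot g *v u g = a}"

definition is_reps :: "'n::finite euc set \<Rightarrow> 'n euc set \<Rightarrow> 'n euc set \<Rightarrow> bool" where
  "is_reps G H C \<longleftrightarrow> C \<subseteq> G \<and> (\<forall>g\<in>G. \<exists>!c\<in>C. \<exists>t\<in>H. g = emul c t)"

definition grad :: "'n::finite euc set \<Rightarrow> ('n euc \<Rightarrow> real^'n) \<Rightarrow> 'n euc \<Rightarrow> 'n euc \<Rightarrow> real^'n" where
  "grad R u g h = u (emul g h) - transpose (rot h) *v u g"

definition grad_norm :: "'n::finite euc set \<Rightarrow> 'n euc set \<Rightarrow> ('n euc \<Rightarrow> real^'n) \<Rightarrow> real" where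
  "grad_norm R C u = sqrt ((1 / real (card C)) * (\<Sum>g\<in>C. \<Sum>h\<in>R. (norm (grad R u g h))\<^sup>2))"

text \<open>The seminorm u \<mapsto> \<parallel>\<nabla>_R u\<parallel>_2 on U_per: for a T^N-periodic u (N \<in> M) use a
  fixed set C_N of representatives of G / T^N.\<close>
definition C_reps :: "'n::finite euc set \<Rightarrow> 'n euc set \<Rightarrow> nat \<Rightarrow> 'n euc set" where
  "C_reps G T N = (SOME C. is_reps G (Tpow T N) C)"

definition grad_seminorm ::
  "'n::finite euc set \<Rightarrow> 'n euc set \<Rightarrow> 'n euc set \<Rightarrow> ('n euc \<Rightarrow> real^'n) \<Rightarrow> real" where
  "grad_seminorm G T R u =
     (let N = (SOME N. N \<in> Mset G T \<and> periodic G (Tpow T N) u)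
      in grad_norm R (C_reps G T N) u)"

end

theory Submission
  imports Defs
begin

text \<open>The relation \<open>\<nabla>u(g)(hk) = \<nabla>u(gh)(k) + rot(k)\<^sup>T \<nabla>u(g)(h)\<close>, the isometry of the rotations
  and the invariance of averages over \<open>G / T\<^sup>N\<close> under right translation show that the elements
  \<open>h\<close> whose difference seminorm is bounded by a multiple of \<open>\<parallel>\<nabla>\<^sub>R u\<parallel>\<^sub>2\<close> form a subgroup; it contains \<open>R\<close>,
  hence is all of \<open>G\<close>. This gives the equivalence and the kernel, provided that \<open>T\<^sup>N\<close> has finite index.
  The latter rests on Bieberbach's first theorem, proved here by a variant of Buser's argument: if \<open>g\<close> has
  minimal translation part among the elements of \<open>S\<close> with small nontrivial rotation, commutators with \<open>g\<close>
  shrink, without killing, the translation part of an almost pure translation along a direction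
  that \<open>rot g\<close> moves the most; this contradicts discreteness.\<close>

section \<open>Discrete subgroups of the Euclidean group\<close>

text \<open>As a simp rule it would turn \<open>transpose A *v x\<close> into \<open>x v* A\<close>
  and hide the inverse rotations.\<close>

declare transpose_matrix_vector [simp del]

lemma matrix_vector_mult_minus: "(A :: real^'n^'m) *v (- x) = - (A *v x)"
  by (simp add: matrix_vector_mult_def sum_negf vec_eq_iff)

lemma emul_assoc: "emul (emul a b) c = emul a (emul b c)"
  by (simp add: emul_def matrix_mul_assoc matrix_vector_mul_assoc algebra_simps)

lemma emul_eone [simp]: "emul eone g = g" "emul g eone = g"
  by (simp_all add: emul_def eone_def)

lemma emul_einv [simp]:
  assumes "in_E g"
  shows "emul (einv g) g = eone" "emul g (einv g) = eone"
  using assms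
  by (simp_all add: emul_def einv_def eone_def in_E_def orthogonal_matrix_def
      matrix_vector_mul_assoc matrix_vector_mult_minus)

lemma emul_einv_cancel [simp]:
  assumes "in_E g"
  shows "emul (einv g) (emul g h) = h" "emul g (emul (einv g) h) = h"
  using assms by (simp_all flip: emul_assoc)

lemma fst_emul [simp]: "fst (emul g h) = fst g ** fst h"
  and snd_emul: "snd (emul g h) = snd g + fst g *v snd h"
  by (simp_all add: emul_def)

lemma fst_einv [simp]: "fst (einv g) = transpose (fst g)"
  and snd_einv: "snd (einv g) = - (transpose (fst g) *v snd g)"
  by (simp_all add: einv_def)

lemma fst_eone [simp]: "fst eone = mat 1" and snd_eone [simp]: "snd eone = 0"
  by (simp_all add: eone_def)

lemma euclid_subgroupD:
  assumes "euclid_subgroup H"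
  shows "g \<in> H \<Longrightarrow> in_E g" "eone \<in> H"
    "g \<in> H \<Longrightarrow> h \<in> H \<Longrightarrow> emul g h \<in> H" "g \<in> H \<Longrightarrow> einv g \<in> H"
  using assms by (auto simp: euclid_subgroup_def)

lemma orthogonal_matrix_norm:
  fixes A :: "real^'n^'n"
  assumes "orthogonal_matrix A"
  shows "norm (A *v x) = norm x" "norm (transpose A *v x) = norm x"
proof -
  have *: "norm (B *v x) = norm x" if "orthogonal_matrix B" for B :: "real^'n^'n"
    using that matrix_of_matrix_vector_mul[of B]
    by (intro orthogonal_transformation_norm) (simp add: orthogonal_transformation_matrix)
  show "norm (A *v x) = norm x" "norm (transpose A *v x) = norm x"
    using assms by (simp_all add: *)
qed

lemma bounded_bilinear_matrix_matrix_mult: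
  "bounded_bilinear ((**) :: real^'n^'m \<Rightarrow> real^'p^'n \<Rightarrow> real^'p^'m)"
  unfolding bilinear_conv_bounded_bilinear[symmetric] bilinear_def
  by (intro conjI allI linearI)
    (simp_all add: matrix_matrix_mult_def vec_eq_iff algebra_simps sum.distrib sum_distrib_left)

lemma bounded_bilinear_matrix_vector_mult:
  "bounded_bilinear ((*v) :: real^'n^'m \<Rightarrow> real^'n \<Rightarrow> real^'m)"
  unfolding bilinear_conv_bounded_bilinear[symmetric] bilinear_def
  by (intro conjI allI linearI)
    (simp_all add: matrix_vector_right_distrib matrix_vector_mult_add_rdistrib
      matrix_vector_mult_scaleR scaleR_matrix_vector_assoc)

lemma bounded_linear_transpose: "bounded_linear (transpose :: real^'n^'m \<Rightarrow> real^'m^'n)"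
  unfolding linear_conv_bounded_linear[symmetric]
  by (intro linearI) (simp_all add: transpose_def vec_eq_iff)

lemma tendsto_emul:
  assumes "(f \<longlongrightarrow> a) F" "(g \<longlongrightarrow> b) F"
  shows "((\<lambda>x. emul (f x) (g x)) \<longlongrightarrow> emul a b) F"
  unfolding emul_def
  by (intro tendsto_intros assms bounded_bilinear.tendsto[OF bounded_bilinear_matrix_matrix_mult]
      bounded_bilinear.tendsto[OF bounded_bilinear_matrix_vector_mult])

lemma tendsto_einv:
  assumes "(f \<longlongrightarrow> a) F"
  shows "((\<lambda>x. einv (f x)) \<longlongrightarrow> einv a) F"
  unfolding einv_def
  by (intro tendsto_intros assms bounded_linear.tendsto[OF bounded_linear_transpose]
      bounded_bilinear.tendsto[OF bounded_bilinear_matrix_vector_mult])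

text \<open>Bolzano-Weierstrass for an enumeration without repetitions: injectivity survives the
  passage to a subsequence, so consecutive terms are distinct yet eventually close.\<close>

lemma infinite_bounded_convergent_sequence:
  fixes X :: "'a::heine_borel set"
  assumes "infinite X" "bounded X"
  obtains f :: "nat \<Rightarrow> 'a" and l where "inj f" "range f \<subseteq> X" "f \<longlonglongrightarrow> l"
proof -
  obtain f :: "nat \<Rightarrow> 'a" where f: "inj f" "range f \<subseteq> X"
    using assms(1) infinite_countable_subset by blast
  obtain l r where "strict_mono r" "(f \<circ> r) \<longlonglongrightarrow> l"
    using bounded_imp_convergent_subsequence[OF bounded_subset[OF assms(2) f(2)]] by blast
  moreover have "inj (f \<circ> r)"
    using f \<open>strict_mono r\<close> by (simp add: inj_compose strict_mono_imp_inj_on)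
  moreover have "range (f \<circ> r) \<subseteq> X"
    using f by auto
  ultimately show ?thesis
    using that by blast
qed

lemma bounded_orthogonal_matrices: "bounded {A :: real^'n^'n. orthogonal_matrix A}"
proof -
  have "norm A \<le> (\<Sum>i\<in>(UNIV::'n set). 1)" if "orthogonal_matrix A" for A :: "real^'n^'n"
  proof -
    have "norm A \<le> (\<Sum>i\<in>UNIV. norm (A $ i))"
      unfolding norm_vec_def by (rule L2_set_le_sum) simp
    also have "\<dots> = (\<Sum>i\<in>(UNIV::'n set). 1)"
      using that by (simp add: orthogonal_matrix_orthonormal_rows row_def)
    finally show ?thesis .
  qed
  then show ?thesis
    by (auto simp: bounded_iff)
qed

text \<open>Infinitely many elements would yield a convergent sequence of distinct ones; quotients
  of consecutive terms then tend to the identity, which is isolated in \<open>H\<close>.\<close>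

lemma finite_discrete_ball:
  fixes H :: "'n::finite euc set"
  assumes H: "euclid_subgroup H" and disc: "discrete_set H"
  shows "finite {g\<in>H. norm (snd g) \<le> r}" (is "finite ?X")
proof (rule ccontr)
  assume inf: "infinite ?X"
  have "?X \<subseteq> {A. orthogonal_matrix A} \<times> cball 0 r"
    using euclid_subgroupD(1)[OF H] by (auto simp: in_E_def)
  then have "bounded ?X"
    by (rule bounded_subset[rotated]) (intro bounded_Times bounded_orthogonal_matrices bounded_cball)
  with inf obtain f l where f: "inj f" "range f \<subseteq> ?X" "f \<longlonglongrightarrow> l"
    using infinite_bounded_convergent_sequence by blast
  have fH: "f n \<in> H" for n
    using f by auto
  have fE: "in_E (f n)" for n
    using fH H euclid_subgroupD by blast
  have "(\<lambda>n. emul (einv (f n)) (f (Suc n))) \<longlonglongrightarrow> emul (einv l) l"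
    by (intro tendsto_emul tendsto_einv f LIMSEQ_Suc)
  \<comment> \<open>The limit \<open>l\<close> is not known to lie in \<open>H\<close>; the identity
    is inherited from the sequence, where it holds termwise.\<close>
  moreover have "emul (einv l) l = eone"
  proof (rule LIMSEQ_unique)
    show "(\<lambda>n. emul (einv (f n)) (f n)) \<longlonglongrightarrow> emul (einv l) l"
      by (intro tendsto_emul tendsto_einv f)
  qed (simp add: fE)
  moreover obtain e where e: "e > 0" "\<And>h. h \<in> H \<Longrightarrow> dist h eone < e \<Longrightarrow> h = eone"
    using bspec[OF disc[unfolded discrete_set_def] euclid_subgroupD(2)[OF H]] by blast
  ultimately have "\<forall>\<^sub>F n in sequentially. dist (emul (einv (f n)) (f (Suc n))) eone < e"
    using e(1) by (auto dest: tendstoD)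
  then obtain n where "dist (emul (einv (f n)) (f (Suc n))) eone < e"
    using eventually_happens'[OF sequentially_bot] by blast
  then have "emul (einv (f n)) (f (Suc n)) = eone"
    by (intro e(2) euclid_subgroupD[OF H] fH)
  then have "f (Suc n) = f n"
    by (metis emul_einv_cancel(2) emul_eone(2) fE)
  then show False
    using f(1) by (metis injD n_not_Suc_n)
qed

text \<open>Only finitely many competitors have a translation part no longer than that of a given
  element, so the minimum is attained. This supplies both extremal elements of the descent.\<close>

lemma ex_min_translation:
  fixes H :: "'n::finite euc set"
  assumes H: "euclid_subgroup H" and disc: "discrete_set H" and X: "X \<subseteq> H" "X \<noteq> {}"
  obtains g where "g \<in> X" "\<And>h. h \<in> X \<Longrightarrow> norm (snd g) \<le> norm (snd h)"
proof -
  obtain x where x: "x \<in> X"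
    using X by blast
  define Y where "Y = {g\<in>X. norm (snd g) \<le> norm (snd x)}"
  have "finite Y"
    by (rule finite_subset[OF _ finite_discrete_ball[OF H disc, of "norm (snd x)"]])
      (use X in \<open>auto simp: Y_def\<close>)
  moreover have "x \<in> Y"
    using x by (simp add: Y_def)
  ultimately obtain g where g: "g \<in> Y" "\<And>h. h \<in> Y \<Longrightarrow> \<not> norm (snd h) < norm (snd g)"
    using arg_min_if_finite[of Y "\<lambda>g. norm (snd g)"] by blast
  show ?thesis
  proof
    show "g \<in> X"
      using g by (simp add: Y_def)
    show "norm (snd g) \<le> norm (snd h)" if "h \<in> X" for h
      using g that unfolding Y_def mem_Collect_eq by (meson linear not_less order_trans)
  qed
qed

section \<open>Distance of a rotation from the identity and the directions it moves the most\<close>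

definition defect :: "real^'n^'n \<Rightarrow> real" where
  "defect A = onorm (\<lambda>x. A *v x - x)"

lemma bounded_linear_defect: "bounded_linear (\<lambda>x. A *v x - x)" for A :: "real^'n^'n"
  by (intro bounded_linear_sub matrix_vector_mul_bounded_linear bounded_linear_ident)

lemma norm_le_defect: "norm (A *v x - x) \<le> defect A * norm x" for A :: "real^'n^'n"
  unfolding defect_def by (rule onorm[OF bounded_linear_defect])

lemma defect_nonneg: "defect A \<ge> 0" for A :: "real^'n^'n"
  unfolding defect_def by (rule onorm_pos_le[OF bounded_linear_defect])

lemma defect_le:
  fixes A :: "real^'n^'n"
  assumes "\<And>x. norm (A *v x - x) \<le> c * norm x"
  shows "defect A \<le> c"
  unfolding defect_def using assms by (rule onorm_le)

lemma defect_eq_0_iff: "defect A = 0 \<longleftrightarrow> A = mat 1" for A :: "real^'n^'n"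
  unfolding defect_def onorm_eq_0[OF bounded_linear_defect] matrix_eq by simp

lemma orthogonal_matrix_inverse:
  fixes A :: "real^'n^'n"
  assumes "orthogonal_matrix A"
  shows "A *v (transpose A *v x) = x" "transpose A *v (A *v x) = x"
  using assms by (simp_all add: matrix_vector_mul_assoc orthogonal_matrix_def)

lemma orthogonal_matrix_inner:
  fixes A :: "real^'n^'n"
  assumes "orthogonal_matrix A"
  shows "(A *v x) \<bullet> (A *v y) = x \<bullet> y"
proof -
  have "orthogonal_transformation ((*v) A)"
    using assms by (simp add: orthogonal_transformation_matrix)
  then show ?thesis
    by (simp add: orthogonal_transformation_def)
qed

lemma inner_transpose: "x \<bullet> (A *v y) = (transpose A *v x) \<bullet> y" for A :: "real^'n^'n"
  by (simp add: transpose_matrix_vector dot_lmul_matrix)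

text \<open>The second conjunct says, in weak form, that \<open>v\<close> is an eigenvector of
  \<open>(A - 1)\<^sup>T (A - 1)\<close> for its largest eigenvalue.\<close>
definition top_direction :: "real^'n^'n \<Rightarrow> real^'n \<Rightarrow> bool" where
  "top_direction A v \<longleftrightarrow> norm v = 1 \<and>
     (\<forall>x. (A *v x - x) \<bullet> (A *v v - v) = (defect A)\<^sup>2 * (x \<bullet> v))"

text \<open>A maximizer \<open>v\<close> of the displacement on the unit sphere works. With
  \<open>N = A - 1\<close>, the vector \<open>N\<^sup>T (N v)\<close> has length at most
  \<open>m\<^sup>2\<close> and inner product exactly \<open>m\<^sup>2\<close> with the unit vector
  \<open>v\<close>, so the equality case of Cauchy-Schwarz identifies it with
  \<open>m\<^sup>2 v\<close>.\<close>

lemma ex_top_direction: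
  fixes A :: "real^'n^'n"
  assumes A: "orthogonal_matrix A"
  shows "\<exists>v. top_direction A v"
proof -
  define N where "N = (\<lambda>x. A *v x - x)"
  define m where "m = defect A"
  have "sphere (0::real^'n) 1 \<noteq> {}"
    by simp
  moreover have "continuous_on (sphere 0 1) (\<lambda>x. norm (N x))"
    unfolding N_def by (intro continuous_intros)
  ultimately obtain v where v: "norm v = 1"
    and max: "\<And>x. norm x = 1 \<Longrightarrow> norm (N x) \<le> norm (N v)"
    using continuous_attains_sup[OF compact_sphere] by (metis dist_0_norm mem_sphere)
  have "norm (N x) \<le> norm (N v) * norm x" for x
  proof (cases "x = 0")
    case False
    have "N ((1 / norm x) *\<^sub>R x) = (1 / norm x) *\<^sub>R N x"
      by (simp add: N_def algebra_simps)
    with max[of "(1 / norm x) *\<^sub>R x"] False show ?thesis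
      by (simp add: field_simps)
  qed (simp add: N_def)
  then have "m \<le> norm (N v)"
    unfolding m_def N_def by (rule defect_le)
  then have m: "norm (N v) = m"
    using norm_le_defect[of A v] v by (simp add: N_def m_def)
  \<comment> \<open>Orthogonality of \<open>A\<close> gives
    \<open>N\<^sup>T = - A\<^sup>T N\<close>, so \<open>z\<close> is the transpose of
    \<open>N\<close> applied to \<open>N v\<close>.\<close>
  define z where "z = - (transpose A *v N (N v))"
  have z: "N x \<bullet> N v = x \<bullet> z" for x
  proof -
    have "x \<bullet> z = - (A *v x) \<bullet> N (N v)"
      using inner_transpose[of x "transpose A" "N (N v)"] by (simp add: z_def)
    also have "\<dots> = N x \<bullet> N v"
      unfolding N_def matrix_vector_mult_diff_distrib inner_diff_left inner_diff_right
        inner_minus_left orthogonal_matrix_inner[OF A] by simp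
    finally show ?thesis ..
  qed
  have "norm z \<le> m * m"
    using norm_le_defect[of A "N v"] A m by (simp add: z_def orthogonal_matrix_norm m_def N_def)
  then have "z \<bullet> z \<le> (m * m) * (m * m)"
    by (simp add: dot_square_norm power2_eq_square mult_mono)
  moreover have "v \<bullet> z = m * m"
    using z[of v] m by (simp add: dot_square_norm power2_eq_square)
  ultimately have "(z - m\<^sup>2 *\<^sub>R v) \<bullet> (z - m\<^sup>2 *\<^sub>R v) \<le> 0"
    using v by (simp add: inner_diff_left inner_diff_right inner_commute norm_eq_1 power2_eq_square)
  then have "z = m\<^sup>2 *\<^sub>R v"
    by (metis eq_iff_diff_eq_0 inner_eq_zero_iff inner_ge_zero order_antisym)
  then show ?thesis
    using z v by (auto simp: top_direction_def N_def m_def)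
qed

text \<open>\<open>A\<close> commutes with \<open>(A - 1)\<^sup>T (A - 1)\<close>, hence
  \<open>A - 1\<close> preserves the eigenspace of the largest eigenvalue; division by the defect
  normalizes.\<close>

lemma top_direction_step:
  fixes A :: "real^'n^'n"
  assumes A: "orthogonal_matrix A" and v: "top_direction A v" and pos: "defect A > 0"
  shows "top_direction A ((1 / defect A) *\<^sub>R (A *v v - v))" (is "top_direction A ?w")
proof -
  define m where "m = defect A"
  have top: "(A *v x - x) \<bullet> (A *v v - v) = m\<^sup>2 * (x \<bullet> v)" for x
    using v by (simp add: top_direction_def m_def)
  have "(norm (A *v v - v))\<^sup>2 = m\<^sup>2 * (norm v)\<^sup>2"
    using top[of v] by (simp add: dot_square_norm)
  then have "norm (A *v v - v) = m"
    using v defect_nonneg[of A] by (simp add: top_direction_def m_def)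
  moreover have "(A *v x - x) \<bullet> (A *v ?w - ?w) = m\<^sup>2 * (x \<bullet> ?w)" for x
  proof -
    \<comment> \<open>The identity for \<open>v\<close> at \<open>y\<close>, transported by the
      isometry \<open>A\<close>, is the identity for \<open>A v\<close> at \<open>x\<close>;
      subtracting the one for \<open>v\<close> gives that for \<open>A v - v\<close>.\<close>
    define y where "y = transpose A *v x"
    have x: "x = A *v y"
      using A by (simp add: y_def orthogonal_matrix_inverse)
    have "(A *v x - x) \<bullet> (A *v (A *v v) - A *v v) = m\<^sup>2 * (x \<bullet> (A *v v))"
      using top[of y] unfolding x matrix_vector_mult_diff_distrib[symmetric]
      by (simp add: orthogonal_matrix_inner[OF A])
    with top[of x] have "(A *v x - x) \<bullet> (A *v (A *v v - v) - (A *v v - v)) = m\<^sup>2 * (x \<bullet> (A *v v - v))"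
      unfolding matrix_vector_mult_diff_distrib inner_diff_right right_diff_distrib by linarith
    moreover have "A *v ?w - ?w = (1 / m) *\<^sub>R (A *v (A *v v - v) - (A *v v - v))"
      by (simp add: m_def algebra_simps)
    ultimately show ?thesis
      by (simp add: m_def)
  qed
  ultimately show ?thesis
    using pos by (simp add: top_direction_def m_def)
qed

text \<open>For orthogonal \<open>B\<close>, \<open>A B\<^sup>T - 1 = (A - B) B\<^sup>T\<close>. The
  constant \<open>K\<close> compares the operator norm with the norm behind
  \<open>dist\<close>.\<close>

lemma defect_mult_transpose:
  obtains K where "K > 0"
    "\<And>A B :: real^'n^'n. orthogonal_matrix B \<Longrightarrow> defect (A ** transpose B) \<le> K * dist A B"
proof -
  obtain K where K: "K > 0" "\<And>(A::real^'n^'n) x. norm (A *v x) \<le> norm A * norm x * K"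
    using bounded_bilinear.pos_bounded[OF bounded_bilinear_matrix_vector_mult] by metis
  have "defect (A ** transpose B) \<le> K * dist A B" if B: "orthogonal_matrix B" for A B :: "real^'n^'n"
  proof (rule defect_le)
    fix x
    define y where "y = transpose B *v x"
    have "x = B *v y" "norm x = norm y"
      using B by (simp_all add: y_def orthogonal_matrix_inverse orthogonal_matrix_norm)
    then have "(A ** transpose B) *v x - x = (A - B) *v y"
      by (simp add: y_def algebra_simps flip: matrix_vector_mul_assoc)
    with K(2)[of "A - B" y] \<open>norm x = norm y\<close>
    show "norm ((A ** transpose B) *v x - x) \<le> K * dist A B * norm x"
      by (simp add: dist_norm mult_ac)
  qed
  with K(1) show ?thesis
    using that by blast
qed

text \<open>The usual commutator with both inverses merged into one: multiplying by
  \<open>h g\<close> on the right gives back \<open>g h\<close>, and the estimates below are read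
  off from that equation.\<close>

definition ecomm :: "'n::finite euc \<Rightarrow> 'n euc \<Rightarrow> 'n euc" where
  "ecomm g h = emul (emul g h) (einv (emul h g))"

lemma in_E_emul: "in_E g \<Longrightarrow> in_E h \<Longrightarrow> in_E (emul g h)"
  by (simp add: in_E_def orthogonal_matrix_mul)

text \<open>For the rotations, \<open>A B - B A = (A - 1) (B - 1) - (B - 1) (A - 1)\<close>, so the
  defects multiply. In the translation part \<open>(A - 1) b\<close> is the leading term; the error
  involves only the defects of the commutator and of \<open>h\<close>.\<close>

lemma ecomm_estimates:
  assumes g: "in_E g" and h: "in_E h"
  shows "defect (fst (ecomm g h)) \<le> 2 * defect (fst g) * defect (fst h)"
    and "norm (snd (ecomm g h) - (fst g *v snd h - snd h))
      \<le> defect (fst (ecomm g h)) * norm (snd h) + defect (fst h) * norm (snd g)"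
proof -
  define A where "A = fst g"
  define B where "B = fst h"
  define C where "C = fst (ecomm g h)"
  have A: "orthogonal_matrix A" and B: "orthogonal_matrix B"
    using g h by (simp_all add: in_E_def A_def B_def)
  have eq: "emul (ecomm g h) (emul h g) = emul g h"
    using g h by (simp add: ecomm_def emul_assoc in_E_emul)
  then have C: "C ** (B ** A) = A ** B"
    by (metis A_def B_def C_def fst_emul)
  show "defect (fst (ecomm g h)) \<le> 2 * defect (fst g) * defect (fst h)"
    unfolding A_def[symmetric] B_def[symmetric] C_def[symmetric]
  proof (rule defect_le)
    fix x
    define y where "y = transpose A *v (transpose B *v x)"
    have x: "x = B *v (A *v y)" and xy: "norm x = norm y"
      using A B by (simp_all add: y_def orthogonal_matrix_inverse orthogonal_matrix_norm)
    have "C *v x = A *v (B *v y)"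
      using C by (simp add: x matrix_vector_mul_assoc)
    then have "C *v x - x = (A *v (B *v y - y) - (B *v y - y)) - (B *v (A *v y - y) - (A *v y - y))"
      by (simp add: x algebra_simps)
    also have "norm \<dots> \<le> defect A * norm (B *v y - y) + defect B * norm (A *v y - y)"
      by (rule order_trans[OF norm_triangle_ineq4]) (intro add_mono norm_le_defect)
    also have "\<dots> \<le> defect A * (defect B * norm y) + defect B * (defect A * norm y)"
      by (intro add_mono mult_left_mono norm_le_defect defect_nonneg)
    finally show "norm (C *v x - x) \<le> 2 * defect A * defect B * norm x"
      by (simp add: xy mult_ac)
  qed
  define a where "a = snd g"
  define b where "b = snd h"
  define y where "y = transpose A *v a"
  have a: "a = A *v y" and ay: "norm a = norm y"
    using A by (simp_all add: y_def orthogonal_matrix_inverse orthogonal_matrix_norm)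
  have "snd (ecomm g h) + C *v (b + B *v a) = a + A *v b"
    using arg_cong[OF eq, of snd] by (simp add: snd_emul C_def A_def B_def a_def b_def)
  moreover have "C *v (B *v a) = A *v (B *v y)"
    using C by (simp add: a matrix_vector_mul_assoc matrix_mul_assoc)
  ultimately have "snd (ecomm g h) - (A *v b - b) = - (C *v b - b) - A *v (B *v y - y)"
    by (simp add: algebra_simps a)
  also have "norm \<dots> \<le> norm (C *v b - b) + norm (B *v y - y)"
    using norm_triangle_ineq4[of "- (C *v b - b)" "A *v (B *v y - y)"]
    by (simp only: norm_minus_cancel orthogonal_matrix_norm[OF A])
  also have "\<dots> \<le> defect C * norm b + defect B * norm y"
    by (intro add_mono norm_le_defect)
  finally show "norm (snd (ecomm g h) - (fst g *v snd h - snd h))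
      \<le> defect (fst (ecomm g h)) * norm (snd h) + defect (fst h) * norm (snd g)"
    using ay by (simp add: A_def B_def C_def a_def b_def)
qed

section \<open>Bieberbach's first theorem\<close>

lemma space_groupD:
  assumes "space_group D2 S"
  shows "euclid_subgroup S" "discrete_set S" "s \<in> S \<Longrightarrow> snd s \<in> block2 D2"
    "s \<in> S \<Longrightarrow> i \<notin> D2 \<Longrightarrow> fst s *v axis i 1 = axis i 1"
proof -
  show "euclid_subgroup S" "discrete_set S"
    using assms by (auto simp: space_group_def)
  have b: "block_form D2 s \<and> proj D2 s = s" if "s \<in> S" for s
    using assms that by (auto simp: space_group_def)
  show "snd s \<in> block2 D2" if "s \<in> S"
    using b[OF that] by (auto simp: block_form_def block2_def)
  show "fst s *v axis i 1 = axis i 1" if "s \<in> S" "i \<notin> D2"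
  proof -
    have "fst (proj D2 s) $ j $ i = (if j = i then 1 else 0)" for j
      using that(2) by (simp add: proj_def)
    then have "fst s $ j $ i = (if j = i then 1 else 0)" for j
      using b[OF that(1)] by simp
    then show ?thesis
      unfolding matrix_vector_mult_basis by (simp add: vec_eq_iff column_def axis_def)
  qed
qed

text \<open>If \<open>x = eact s k\<close>, then \<open>x - snd s\<close> is a rotated
  \<open>k\<close>, and the compact set \<open>K\<close> is bounded.\<close>

lemma space_group_cocompact:
  assumes "space_group D2 S"
  shows "\<exists>d\<ge>0. \<forall>x\<in>block2 D2. \<exists>s\<in>S. norm (x - snd s) \<le> d"
proof -
  obtain K where K: "compact K" "\<And>x. x \<in> block2 D2 \<Longrightarrow> \<exists>s\<in>S. \<exists>k\<in>K. x = eact s k"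
    using assms by (auto simp: space_group_def)
  obtain d where d: "d > 0" "\<And>k. k \<in> K \<Longrightarrow> norm k \<le> d"
    using compact_imp_bounded[OF K(1)] by (auto simp: bounded_pos)
  have "\<exists>s\<in>S. norm (x - snd s) \<le> d" if x: "x \<in> block2 D2" for x
  proof -
    obtain s k where sk: "s \<in> S" "k \<in> K" "x = eact s k"
      using K(2)[OF x] by blast
    have "in_E s"
      using sk(1) euclid_subgroupD(1) space_groupD(1)[OF assms] by blast
    then have "norm (x - snd s) \<le> d"
      using d(2)[OF sk(2)] by (simp add: sk(3) eact_def orthogonal_matrix_norm in_E_def)
    with sk(1) show ?thesis
      by blast
  qed
  with d(1) show ?thesis
    by (meson less_imp_le)
qed

text \<open>Elements of \<open>S\<close> move the origin close to \<open>k u\<close> for every \<open>k\<close>; by compactness of the orthogonal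
  group two of them have nearly equal rotations, and their quotient is the required element.\<close>
lemma ex_small_rotation_in_direction:
  assumes S: "space_group D2 S" and u: "u \<in> block2 D2" "norm u = 1" and "\<epsilon> > 0"
  obtains h where "h \<in> S" "defect (fst h) \<le> \<epsilon>" "snd h \<noteq> 0"
    "snd h \<bullet> u \<ge> 3 / 4 * norm (snd h)"
proof -
  obtain d where d: "0 \<le> d" "\<And>x. x \<in> block2 D2 \<Longrightarrow> \<exists>s\<in>S. norm (x - snd s) \<le> d"
    using space_group_cocompact[OF S] by blast
  have SE: "in_E s" if "s \<in> S" for s
    using that euclid_subgroupD(1) space_groupD(1)[OF S] by blast
  have "real k *\<^sub>R u \<in> block2 D2" for k :: nat
    using u(1) by (simp add: block2_def)
  then have "\<exists>s\<in>S. norm (real k *\<^sub>R u - snd s) \<le> d" for k :: nat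
    by (rule d(2))
  then obtain s where s: "\<And>k. s k \<in> S" "\<And>k. norm (real k *\<^sub>R u - snd (s k)) \<le> d"
    by metis
  have orth: "orthogonal_matrix (fst (s k))" for k
    using SE s(1) by (simp add: in_E_def)
  then have "bounded (range (\<lambda>k. fst (s k)))"
    by (intro bounded_subset[OF bounded_orthogonal_matrices]) blast
  then obtain l r where r: "strict_mono r" and "((\<lambda>k. fst (s k)) \<circ> r) \<longlonglongrightarrow> l"
    using bounded_imp_convergent_subsequence by blast
  then have cauchy: "Cauchy (\<lambda>k. fst (s (r k)))"
    unfolding o_def by (intro LIMSEQ_imp_Cauchy)
  obtain K where K: "K > 0"
    "\<And>A B :: real^'a^'a. orthogonal_matrix B \<Longrightarrow> defect (A ** transpose B) \<le> K * dist A B"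
    using defect_mult_transpose by blast
  obtain i where i: "\<And>j. j \<ge> i \<Longrightarrow> dist (fst (s (r j))) (fst (s (r i))) < \<epsilon> / K"
    using metric_CauchyD[OF cauchy, of "\<epsilon> / K"] K(1) \<open>\<epsilon> > 0\<close> by (metis divide_pos_pos order_refl)
  define D where "D = d + norm (snd (s (r i)))"
  have D: "D \<ge> 0"
    using d(1) by (simp add: D_def)
  \<comment> \<open>\<open>p \<ge> 7 * D\<close> gives \<open>p - D \<ge> 3 / 4 * (D + p)\<close>,
    the cone bound; the extra \<open>1\<close> makes \<open>p - D\<close> positive, so the
    translation part is nonzero.\<close>
  obtain j where j: "j \<ge> i" "real j \<ge> 7 * D + 1"
    using real_arch_simple[of "7 * D + 1"] by (metis le_cases le_trans of_nat_mono order_trans)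
  define h where "h = emul (s (r j)) (einv (s (r i)))"
  define p where "p = real (r j)"
  have p: "p \<ge> 7 * D + 1"
    using j(2) seq_suble[OF r, of j] by (simp add: p_def)
  have "snd h = snd (s (r j)) - fst (s (r j)) *v (transpose (fst (s (r i))) *v snd (s (r i)))"
    by (simp add: h_def snd_emul snd_einv matrix_vector_mult_minus)
  then have "snd h - p *\<^sub>R u = - (real (r j) *\<^sub>R u - snd (s (r j)))
      - fst (s (r j)) *v (transpose (fst (s (r i))) *v snd (s (r i)))"
    by (simp add: p_def)
  also have "norm \<dots> \<le> D"
    using s(2)[of "r j"] orth unfolding D_def
    by (intro order_trans[OF norm_triangle_ineq4] add_mono)
      (simp_all only: norm_minus_cancel orthogonal_matrix_norm order_refl)
  finally have near: "norm (snd h - p *\<^sub>R u) \<le> D" .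
  have "snd h \<bullet> u = p + (snd h - p *\<^sub>R u) \<bullet> u"
    using u(2) by (simp add: inner_diff_left norm_eq_1)
  moreover have "\<bar>(snd h - p *\<^sub>R u) \<bullet> u\<bar> \<le> D"
    using Cauchy_Schwarz_ineq2[of "snd h - p *\<^sub>R u" u] near u(2) by simp
  ultimately have hu: "snd h \<bullet> u \<ge> p - D"
    by linarith
  have "norm (snd h) \<le> norm (snd h - p *\<^sub>R u) + norm (p *\<^sub>R u)"
    using norm_triangle_ineq[of "snd h - p *\<^sub>R u" "p *\<^sub>R u"] by simp
  also have "\<dots> \<le> D + p"
    using near u(2) by (simp add: p_def)
  finally have "3 / 4 * norm (snd h) \<le> snd h \<bullet> u"
    using hu p by linarith
  moreover have "snd h \<noteq> 0"
    using hu p D by auto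
  moreover have "h \<in> S"
    unfolding h_def by (intro euclid_subgroupD[OF space_groupD(1)[OF S]] s)
  moreover have "defect (fst h) \<le> \<epsilon>"
  proof -
    have "defect (fst h) \<le> K * dist (fst (s (r j))) (fst (s (r i)))"
      using K(2)[OF orth] by (simp add: h_def)
    also have "\<dots> \<le> \<epsilon>"
      using i[OF j(1)] K(1) by (simp add: field_simps)
    finally show ?thesis .
  qed
  ultimately show ?thesis
    using that by blast
qed

text \<open>A top direction is an eigenvector of a symmetric map for a positive eigenvalue, hence
  orthogonal to the axis vectors outside \<open>D2\<close>, which \<open>S\<close> fixes.
  Cocompactness thus applies along it.\<close>

lemma top_direction_in_block2:
  assumes S: "space_group D2 S" and g: "g \<in> S" and v: "top_direction (fst g) v"
    and pos: "defect (fst g) > 0"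
  shows "v \<in> block2 D2"
proof -
  have "v $ i = 0" if "i \<notin> D2" for i
  proof -
    have "(fst g *v axis i 1 - axis i 1) \<bullet> (fst g *v v - v) = (defect (fst g))\<^sup>2 * (axis i 1 \<bullet> v)"
      using v by (simp add: top_direction_def)
    then have "axis i 1 \<bullet> v = 0"
      using space_groupD(4)[OF S g that] pos by simp
    then show ?thesis
      by (simp add: inner_axis')
  qed
  then show ?thesis
    by (simp add: block2_def)
qed

text \<open>Arithmetic of the descent step: \<open>m\<close>, \<open>\<mu>\<close>, \<open>\<mu>'\<close> are the rotation defects of \<open>g\<close>, \<open>h\<close> and
  their commutator, \<open>nb\<close>, \<open>nb'\<close> the translation lengths of \<open>h\<close> and the commutator, and \<open>bv\<close>, \<open>bv'\<close> the
  components of these translations along top directions of \<open>g\<close>. The slack \<open>8 / m * \<mu>\<close> in the cone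
  condition halves at each step, which absorbs the error terms.\<close>
lemma commutator_contracts:
  fixes m \<mu> \<mu>' nb nb' bv bv' :: real
  assumes m: "0 < m" "m \<le> 1 / 4" and \<mu>: "0 \<le> \<mu>" "8 / m * \<mu> \<le> 1 / 4"
    and \<mu>': "0 \<le> \<mu>'" "\<mu>' \<le> \<mu> / 2" and nb: "nb > 0"
    and bv: "bv \<ge> (1 / 2 + 8 / m * \<mu>) * nb"
    and bv': "bv' \<ge> m * bv - 2 * \<mu> * nb"
    and nb': "0 \<le> nb'" "nb' \<le> m * nb + 2 * \<mu> * nb"
  shows "bv' \<ge> (1 / 2 + 8 / m * \<mu>') * nb'" "bv' > 0" "nb' < nb"
proof -
  \<comment> \<open>As \<open>m\<close> is the leading contraction factor, \<open>\<kappa>\<close>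
    is the relative size of the errors.\<close>
  define \<kappa> where "\<kappa> = \<mu> / m"
  have \<kappa>: "\<mu> = \<kappa> * m" "0 \<le> \<kappa>" "\<kappa> \<le> 1 / 32"
    using m \<mu> by (simp_all add: \<kappa>_def field_simps)
  have "8 / m * \<mu> = 8 * \<kappa>"
    by (simp add: \<kappa>_def)
  then have "bv \<ge> (1 / 2 + 8 * \<kappa>) * nb"
    using bv by simp
  then have "m * bv \<ge> m * ((1 / 2 + 8 * \<kappa>) * nb)"
    using m by (intro mult_left_mono) auto
  then have lower: "bv' \<ge> m * nb * (1 / 2 + 6 * \<kappa>)"
    using bv' by (simp add: \<kappa>(1) algebra_simps)
  have mn: "m * nb > 0"
    using m nb by simp
  show "bv' > 0"
    using lower mult_pos_pos[OF mn, of "1 / 2 + 6 * \<kappa>"] \<kappa>(2) by linarith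
  have upper: "nb' \<le> m * nb * (1 + 2 * \<kappa>)"
    using nb'(2) by (simp add: \<kappa>(1) algebra_simps)
  also have "\<dots> \<le> (1 / 4 * nb) * (1 + 2 * \<kappa>)"
    using m nb \<kappa> by (intro mult_right_mono) auto
  also have "\<dots> < nb"
    using mult_strict_left_mono[of "1 + 2 * \<kappa>" 4 nb] nb \<kappa>(3) by simp
  finally show "nb' < nb" .
  show "bv' \<ge> (1 / 2 + 8 / m * \<mu>') * nb'"
  proof -
    have "8 / m * \<mu>' \<le> 4 * \<kappa>"
      using \<mu>'(2) m by (simp add: \<kappa>_def field_simps)
    then have "(1 / 2 + 8 / m * \<mu>') * nb' \<le> (1 / 2 + 4 * \<kappa>) * (m * nb * (1 + 2 * \<kappa>))"
      using upper \<kappa> m nb nb' \<mu>' by (intro mult_mono) auto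
    also have "\<dots> = m * nb * (1 / 2 + 5 * \<kappa> + 8 * (\<kappa> * \<kappa>))"
      by (simp add: algebra_simps)
    \<comment> \<open>The quadratic term fits into the spare \<open>\<kappa>\<close>:
      \<open>\<kappa> \<le> 1 / 32\<close> gives
      \<open>8 * \<kappa>\<^sup>2 \<le> \<kappa> / 4\<close>.\<close>
    also have "\<dots> \<le> m * nb * (1 / 2 + 6 * \<kappa>)"
      using mn \<kappa>(2) mult_left_mono[OF \<kappa>(3,2)] by (intro mult_left_mono) simp_all
    finally show ?thesis
      using lower by linarith
  qed
qed

text \<open>Two minimal choices collide: \<open>g\<close> is shortest among elements with small
  nontrivial rotation, \<open>h\<close> is shortest among the almost pure translations in a cone
  about a top direction of \<open>g\<close>; their commutator is a shorter competitor for
  \<open>h\<close>.\<close>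

lemma small_rotation_trivial:
  assumes S: "space_group D2 S" and "g0 \<in> S" "defect (fst g0) \<le> 1 / 4"
  shows "fst g0 = mat 1"
proof (rule ccontr)
  assume "fst g0 \<noteq> mat 1"
  note SG = space_groupD(1,2)[OF S]
  have SE: "in_E s" if "s \<in> S" for s
    using that euclid_subgroupD(1)[OF SG(1)] by blast
  define X where "X = {g\<in>S. 0 < defect (fst g) \<and> defect (fst g) \<le> 1 / 4}"
  have "g0 \<in> X"
    using assms \<open>fst g0 \<noteq> mat 1\<close> defect_eq_0_iff[of "fst g0"] defect_nonneg[of "fst g0"]
    by (simp add: X_def)
  then obtain g where "g \<in> X" and g_min: "\<And>h. h \<in> X \<Longrightarrow> norm (snd g) \<le> norm (snd h)"
    using ex_min_translation[OF SG, of X] unfolding X_def by blast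
  define A where "A = fst g"
  define m where "m = defect A"
  have g: "g \<in> S" and m: "0 < m" "m \<le> 1 / 4"
    using \<open>g \<in> X\<close> by (auto simp: X_def m_def A_def)
  have A: "orthogonal_matrix A"
    using SE[OF g] by (simp add: in_E_def A_def)
  \<comment> \<open>The direction \<open>v\<close> is existentially quantified because a commutator
    step replaces it by the normalized \<open>A v - v\<close>.\<close>
  define Y where "Y = {h\<in>S. snd h \<noteq> 0 \<and> 8 / m * defect (fst h) \<le> 1 / 4 \<and>
    (\<exists>v. top_direction A v \<and> snd h \<bullet> v \<ge> (1 / 2 + 8 / m * defect (fst h)) * norm (snd h))}"
  obtain v0 where v0: "top_direction A v0"
    using ex_top_direction[OF A] by blast
  have "v0 \<in> block2 D2" "norm v0 = 1"
    using top_direction_in_block2[OF S g] v0 m by (auto simp: A_def m_def top_direction_def)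
  \<comment> \<open>A defect of at most \<open>m / 32\<close> keeps the slack
    \<open>8 / m * \<mu>\<close> below \<open>1 / 4\<close>, so the required slope is at most
    \<open>1 / 2 + 1 / 4\<close>, the \<open>3 / 4\<close> available for \<open>h0\<close>.\<close>
  moreover have "m / 32 > 0"
    using m by simp
  ultimately obtain h0 where h0: "h0 \<in> S" "defect (fst h0) \<le> m / 32" "snd h0 \<noteq> 0"
    "snd h0 \<bullet> v0 \<ge> 3 / 4 * norm (snd h0)"
    using ex_small_rotation_in_direction[OF S] by blast
  have small: "8 / m * defect (fst h0) \<le> 1 / 4"
    using h0(2) m by (simp add: field_simps)
  have "(1 / 2 + 8 / m * defect (fst h0)) * norm (snd h0) \<le> 3 / 4 * norm (snd h0)"
    using small by (intro mult_right_mono) auto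
  then have "h0 \<in> Y"
    using h0 small v0 unfolding Y_def mem_Collect_eq by (meson order_trans)
  then obtain h where "h \<in> Y" and h_min: "\<And>k. k \<in> Y \<Longrightarrow> norm (snd h) \<le> norm (snd k)"
    using ex_min_translation[OF SG, of Y] unfolding Y_def by blast
  define \<mu> where "\<mu> = defect (fst h)"
  define b where "b = snd h"
  obtain v where h: "h \<in> S" "b \<noteq> 0" "8 / m * \<mu> \<le> 1 / 4" "top_direction A v"
    "b \<bullet> v \<ge> (1 / 2 + 8 / m * \<mu>) * norm b"
    using \<open>h \<in> Y\<close> by (auto simp: Y_def \<mu>_def b_def)
  define k where "k = ecomm g h"
  define \<mu>' where "\<mu>' = defect (fst k)"
  define b' where "b' = snd k"
  define w where "w = (1 / m) *\<^sub>R (A *v v - v)"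
  have k: "k \<in> S"
    unfolding k_def ecomm_def by (intro euclid_subgroupD[OF SG(1)] g h)
  have w: "top_direction A w"
    unfolding w_def m_def using top_direction_step[OF A h(4)] m by (simp add: m_def)
  have \<mu>0: "0 \<le> \<mu>" "0 \<le> \<mu>'"
    by (simp_all add: \<mu>_def \<mu>'_def defect_nonneg)
  have "\<mu>' \<le> 2 * m * \<mu>"
    using ecomm_estimates(1)[OF SE[OF g] SE[OF h(1)]] by (simp add: \<mu>'_def \<mu>_def m_def A_def k_def)
  also have "\<dots> \<le> 2 * (1 / 4) * \<mu>"
    using m \<mu>0 by (intro mult_right_mono) auto
  finally have \<mu>': "\<mu>' \<le> \<mu> / 2"
    by simp
  have mu_le: "\<mu> \<le> 1 / 4"
    using h(3) m \<mu>0 by (simp add: field_simps)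
  \<comment> \<open>Minimality of \<open>g\<close> enters: if \<open>h\<close> has nontrivial
    rotation it competes with \<open>g\<close>, otherwise both sides vanish. This removes the
    translation length of \<open>g\<close> from the error.\<close>
  have ab: "\<mu> * norm (snd g) \<le> \<mu> * norm b"
  proof (cases "\<mu> = 0")
    case False
    then have "h \<in> X"
      using h(1) \<mu>0 mu_le by (simp add: X_def \<mu>_def)
    then show ?thesis
      using g_min \<mu>0 by (simp add: b_def mult_left_mono)
  qed simp
  have "norm (b' - (A *v b - b)) \<le> \<mu>' * norm b + \<mu> * norm (snd g)"
    using ecomm_estimates(2)[OF SE[OF g] SE[OF h(1)]]
    by (simp add: \<mu>'_def \<mu>_def A_def k_def b'_def b_def)
  also have "\<dots> \<le> \<mu> * norm b + \<mu> * norm b"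
    using ab \<mu>' \<mu>0 by (intro add_mono mult_right_mono) auto
  finally have err: "norm (b' - (A *v b - b)) \<le> 2 * \<mu> * norm b"
    by simp
  have "(A *v b - b) \<bullet> w = m * (b \<bullet> v)"
    using h(4) m by (simp add: top_direction_def w_def m_def power2_eq_square)
  then have "b' \<bullet> w = m * (b \<bullet> v) + (b' - (A *v b - b)) \<bullet> w"
    by (simp add: inner_diff_left)
  moreover have "\<bar>(b' - (A *v b - b)) \<bullet> w\<bar> \<le> 2 * \<mu> * norm b"
    using Cauchy_Schwarz_ineq2[of "b' - (A *v b - b)" w] err w by (simp add: top_direction_def)
  ultimately have bv': "b' \<bullet> w \<ge> m * (b \<bullet> v) - 2 * \<mu> * norm b"
    by linarith
  have "norm b' \<le> norm (A *v b - b) + norm (b' - (A *v b - b))"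
    using norm_triangle_ineq[of "A *v b - b" "b' - (A *v b - b)"] by simp
  also have "\<dots> \<le> m * norm b + 2 * \<mu> * norm b"
    using err by (intro add_mono) (simp_all add: m_def norm_le_defect)
  finally have nb': "norm b' \<le> m * norm b + 2 * \<mu> * norm b" .
  have nb: "norm b > 0"
    using h(2) by simp
  note step = commutator_contracts[OF m \<mu>0(1) h(3) \<mu>0(2) \<mu>' nb h(5) bv' norm_ge_zero nb']
  have "8 / m * \<mu>' \<le> 8 / m * \<mu>"
    using \<mu>' \<mu>0 m by (intro mult_left_mono) auto
  moreover have "b' \<noteq> 0"
    using step(2) by auto
  ultimately have "k \<in> Y"
    using k w step(1) h(3) unfolding Y_def \<mu>'_def b'_def by auto
  then have "norm b \<le> norm b'"
    unfolding b_def b'_def by (rule h_min)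
  with step(3) show False
    by simp
qed

text \<open>Infinitely many rotations would accumulate, giving two distinct ones whose quotient has
  defect at most \<open>1 / 4\<close>, which \<open>small_rotation_trivial\<close> forbids.\<close>

lemma finite_point_group:
  assumes S: "space_group D2 S"
  shows "finite (fst ` S)"
proof (rule ccontr)
  assume inf: "infinite (fst ` S)"
  have SE: "in_E s" if "s \<in> S" for s
    using that euclid_subgroupD(1)[OF space_groupD(1)[OF S]] by blast
  have "fst ` S \<subseteq> {A. orthogonal_matrix A}"
    using SE unfolding in_E_def by blast
  then have "bounded (fst ` S)"
    using bounded_subset[OF bounded_orthogonal_matrices] by blast
  with inf obtain f l where f: "inj f" "range f \<subseteq> fst ` S" "f \<longlonglongrightarrow> l"
    using infinite_bounded_convergent_sequence by blast
  obtain K where K: "K > 0"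
    "\<And>A B :: real^'a^'a. orthogonal_matrix B \<Longrightarrow> defect (A ** transpose B) \<le> K * dist A B"
    using defect_mult_transpose by blast
  have "1 / 4 / K > 0"
    using K(1) by simp
  then obtain i where "\<And>j. j \<ge> i \<Longrightarrow> dist (f j) (f i) < 1 / 4 / K"
    using metric_CauchyD[OF LIMSEQ_imp_Cauchy[OF f(3)]] by (metis order_refl)
  then have close: "dist (f (Suc i)) (f i) < 1 / 4 / K"
    by simp
  obtain s t where st: "s \<in> S" "t \<in> S" "f (Suc i) = fst s" "f i = fst t"
    using f(2) by (meson imageE range_subsetD)
  have t: "orthogonal_matrix (fst t)"
    using SE st(2) by (simp add: in_E_def)
  have "defect (fst s ** transpose (fst t)) \<le> K * dist (fst s) (fst t)"
    using t by (rule K(2))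
  also have "\<dots> \<le> 1 / 4"
    using close K(1) by (simp add: st field_simps)
  finally have "fst (emul s (einv t)) = mat 1"
    using st by (intro small_rotation_trivial[OF S] euclid_subgroupD[OF space_groupD(1)[OF S]]) auto
  then have "(fst s ** transpose (fst t)) ** fst t = fst t"
    by simp
  then have "fst s = fst t"
    using t by (simp add: orthogonal_matrix_def flip: matrix_mul_assoc)
  then show False
    using f(1) st by (metis injD n_not_Suc_n)
qed

text \<open>Dividing \<open>s\<close> by a fixed element with the same rotation leaves a pure
  translation, at the cost of a shift bounded by \<open>M\<close>; the maximum makes sense because
  the point group is finite.\<close>

lemma translations_relatively_dense:
  assumes S: "space_group D2 S"
  shows "\<exists>D. \<forall>x\<in>block2 D2. \<exists>s\<in>trans_sub S. norm (x - snd s) \<le> D"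
proof -
  from space_group_cocompact[OF S]
  obtain d where d: "\<forall>x\<in>block2 D2. \<exists>s\<in>S. norm (x - snd s) \<le> d"
    by (elim exE conjE)
  define r where "r = (\<lambda>A. SOME s. s \<in> S \<and> fst s = A)"
  have r: "r A \<in> S \<and> fst (r A) = A" if "A \<in> fst ` S" for A
    unfolding r_def by (rule someI_ex[of "\<lambda>s. s \<in> S \<and> fst s = A"]) (use that in blast)
  define M where "M = Max ((\<lambda>A. norm (snd (r A))) ` fst ` S)"
  have "\<exists>s\<in>trans_sub S. norm (x - snd s) \<le> d + M" if x: "x \<in> block2 D2" for x
  proof -
    obtain s where s: "s \<in> S" "norm (x - snd s) \<le> d"
      using bspec[OF d x] by (elim bexE)
    define q where "q = r (fst s)"
    have q: "q \<in> S" "fst q = fst s"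
      using r[of "fst s"] s(1) by (auto simp: q_def)
    have orth: "orthogonal_matrix (fst s)"
      using euclid_subgroupD(1)[OF space_groupD(1)[OF S] s(1)] by (simp add: in_E_def)
    define t where "t = emul s (einv q)"
    have "t \<in> S"
      unfolding t_def by (intro euclid_subgroupD[OF space_groupD(1)[OF S]] s q)
    moreover have "fst t = mat 1"
      using orth by (simp add: t_def q orthogonal_matrix_def)
    moreover have "norm (x - snd t) \<le> d + M"
    proof -
      have "snd t = snd s - snd q"
        using orth by (simp add: t_def snd_emul snd_einv q matrix_vector_mult_minus orthogonal_matrix_inverse)
      then have "x - snd t = (x - snd s) + snd q"
        by simp
      then have "norm (x - snd t) \<le> norm (x - snd s) + norm (snd q)"
        by (simp only: norm_triangle_ineq)
      also have "norm (snd q) \<le> M"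
        unfolding M_def q_def using finite_point_group[OF S] s(1) by (intro Max_ge) auto
      finally show ?thesis
        using s(2) by simp
    qed
    ultimately show ?thesis
      unfolding trans_sub_def by blast
  qed
  then show ?thesis
    by (intro exI ballI)
qed

section \<open>Cosets of a normal subgroup\<close>

lemma normal_subgroupD:
  assumes "normal_subgroup H G"
  shows "euclid_subgroup H" "t \<in> H \<Longrightarrow> t \<in> G"
    "g \<in> G \<Longrightarrow> t \<in> H \<Longrightarrow> emul (emul g t) (einv g) \<in> H"
  using assms by (auto simp: normal_subgroup_def)

lemma einv_einv: "in_E g \<Longrightarrow> einv (einv g) = g"
  by (simp add: einv_def in_E_def matrix_vector_mult_minus orthogonal_matrix_inverse)

lemma normal_subgroup_swap:
  assumes H: "normal_subgroup H G" and G: "euclid_subgroup G" and "t \<in> H" "g \<in> G"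
  shows "\<exists>t'\<in>H. emul t g = emul g t'"
proof
  have g: "in_E g" "einv g \<in> G"
    using euclid_subgroupD[OF G] assms(4) by auto
  show "emul (emul (einv g) t) g \<in> H"
    using normal_subgroupD(3)[OF H g(2) assms(3)] g(1) by (simp add: einv_einv)
  show "emul t g = emul g (emul (emul (einv g) t) g)"
    using g(1) by (simp add: emul_assoc)
qed

text \<open>The choice \<open>r g\<close> depends on \<open>g\<close> only through the set
  \<open>K g\<close>, so equal cosets get equal representatives.\<close>

lemma ex_reps:
  assumes H: "euclid_subgroup H" and "H \<subseteq> G" and G: "euclid_subgroup G"
  shows "\<exists>C. is_reps G H C"
proof -
  define K where "K = (\<lambda>g. emul g ` H)"
  define r where "r = (\<lambda>g. SOME c. c \<in> K g)"
  have K_shift: "K (emul g t) = K g" if t: "t \<in> H" for g t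
  proof -
    have "emul t ` H = H"
    proof (intro equalityI subsetI)
      fix x assume "x \<in> H"
      then have "emul (einv t) x \<in> H" "x = emul t (emul (einv t) x)"
        using euclid_subgroupD[OF H] t by auto
      then show "x \<in> emul t ` H"
        by blast
    qed (use euclid_subgroupD(3)[OF H t] in auto)
    moreover have "K (emul g t) = emul g ` emul t ` H"
      by (simp add: K_def image_image emul_assoc)
    ultimately show ?thesis
      by (simp add: K_def)
  qed
  have r: "\<exists>t\<in>H. r g = emul g t" for g
  proof -
    have "emul g eone \<in> K g"
      unfolding K_def using euclid_subgroupD(2)[OF H] by (rule imageI)
    then have "r g \<in> K g"
      unfolding r_def by (rule someI[of "\<lambda>c. c \<in> K g"])
    then show ?thesis
      by (auto simp: K_def)
  qed
  have r_shift: "r (emul g t) = r g" if "t \<in> H" for g t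
    using K_shift[OF that] by (simp add: r_def)
  have "is_reps G H (r ` G)"
    unfolding is_reps_def
  proof (intro conjI ballI ex1I[where P="\<lambda>c. c \<in> r ` G \<and> (\<exists>t\<in>H. g = emul c t)" and a="r g" for g])
    show "r ` G \<subseteq> G"
      using r euclid_subgroupD(3)[OF G] assms(2) by (metis image_subsetI subsetD)
    fix g assume g: "g \<in> G"
    then show "r g \<in> r ` G"
      by blast
    obtain t where t: "t \<in> H" "r g = emul g t"
      using r by blast
    then have "g = emul (r g) (einv t)"
      using euclid_subgroupD(1)[OF H t(1)] by (simp add: emul_assoc)
    then show "\<exists>t\<in>H. g = emul (r g) t"
      using euclid_subgroupD(4)[OF H t(1)] by blast
  next
    fix g c assume "c \<in> r ` G \<and> (\<exists>t\<in>H. g = emul c t)"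
    then obtain g' t where gt: "c = r g'" "t \<in> H" "g = emul c t"
      by blast
    obtain t' where "t' \<in> H" "r g' = emul g' t'"
      using r by blast
    then show "c = r g"
      using gt r_shift by simp
  qed
  then show ?thesis
    by blast
qed

lemma is_reps_unique:
  assumes C: "is_reps G H C" and H: "euclid_subgroup H" and "c \<in> C" "c' \<in> C" "t \<in> H" "c' = emul c t"
  shows "c' = c"
proof -
  have "c' \<in> G"
    using C assms(4) by (auto simp: is_reps_def)
  then have "\<exists>!k. k \<in> C \<and> (\<exists>t\<in>H. c' = emul k t)"
    using C by (auto simp: is_reps_def)
  moreover have "c' \<in> C \<and> (\<exists>t\<in>H. c' = emul c' t)"
    using assms(4) euclid_subgroupD(2)[OF H] emul_eone(2) by metis
  moreover have "c \<in> C \<and> (\<exists>t\<in>H. c' = emul c t)"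
    using assms(3,5,6) by blast
  ultimately show ?thesis
    by blast
qed

text \<open>By normality, right translation by \<open>k\<close> permutes the left cosets of
  \<open>H\<close>; since \<open>\<phi>\<close> is constant on each, the sum is only
  reordered.\<close>

lemma sum_reps_shift:
  fixes \<phi> :: "'n::finite euc \<Rightarrow> real"
  assumes H: "normal_subgroup H G" and G: "euclid_subgroup G"
    and C: "is_reps G H C" "finite C" and k: "k \<in> G"
    and \<phi>: "\<And>g t. g \<in> G \<Longrightarrow> t \<in> H \<Longrightarrow> \<phi> (emul g t) = \<phi> g"
  shows "(\<Sum>c\<in>C. \<phi> (emul c k)) = (\<Sum>c\<in>C. \<phi> c)"
proof -
  note HS = normal_subgroupD(1)[OF H]
  have CG: "c \<in> G" if "c \<in> C" for c
    using C that by (auto simp: is_reps_def)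
  have "\<exists>c'\<in>C. \<exists>t\<in>H. emul c k = emul c' t" if "c \<in> C" for c
    using C(1) euclid_subgroupD(3)[OF G CG[OF that] k] unfolding is_reps_def by blast
  then obtain \<pi> \<tau> where \<pi>: "\<And>c. c \<in> C \<Longrightarrow> \<pi> c \<in> C" "\<And>c. c \<in> C \<Longrightarrow> \<tau> c \<in> H"
    "\<And>c. c \<in> C \<Longrightarrow> emul c k = emul (\<pi> c) (\<tau> c)"
    by metis
  have "inj_on \<pi> C"
  proof (rule inj_onI)
    fix c d assume cd: "c \<in> C" "d \<in> C" "\<pi> c = \<pi> d"
    define s where "s = emul (einv (\<tau> c)) (\<tau> d)"
    have s: "s \<in> H"
      unfolding s_def by (intro euclid_subgroupD[OF HS] \<pi> cd)
    have "emul d k = emul (emul c k) s"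
      using \<pi> cd euclid_subgroupD(1)[OF HS \<pi>(2)] by (simp add: s_def emul_assoc)
    moreover have kE: "in_E k"
      using euclid_subgroupD(1)[OF G k] .
    ultimately have "d = emul (emul (emul c k) s) (einv k)"
      by (metis emul_assoc emul_eone(2) emul_einv(2))
    then have "d = emul c (emul (emul k s) (einv k))"
      by (simp add: emul_assoc)
    then show "c = d"
      using is_reps_unique[OF C(1) HS cd(1,2) normal_subgroupD(3)[OF H k s]] by simp
  qed
  then have "\<pi> ` C = C"
    using endo_inj_surj[OF C(2)] \<pi>(1) by blast
  have "(\<Sum>c\<in>C. \<phi> (emul c k)) = (\<Sum>c\<in>C. \<phi> (\<pi> c))"
    using \<pi> \<phi> CG by (intro sum.cong) auto
  also have "\<dots> = sum \<phi> (\<pi> ` C)"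
    using sum.reindex[OF \<open>inj_on \<pi> C\<close>, of \<phi>] by simp
  finally show ?thesis
    using \<open>\<pi> ` C = C\<close> by simp
qed

section \<open>Finite index of \<open>Tpow T N\<close> in \<open>G\<close>\<close>

lemma block2_fixed:
  assumes t: "block_form D2 t" and "fst (proj D2 t) = mat 1" and x: "x \<in> block2 D2"
  shows "fst t *v x = x"
proof -
  have "fst t $ i $ j * x $ j = (mat 1 :: real^'a^'a) $ i $ j * x $ j" for i j
  proof (cases "j \<in> D2")
    case j: True
    show ?thesis
    proof (cases "i \<in> D2")
      case True
      have "fst (proj D2 t) $ i $ j = fst t $ i $ j"
        using j True by (simp add: proj_def)
      with assms(2) show ?thesis
        by simp
    next
      case False
      then show ?thesis
        using j t by (auto simp: block_form_def mat_def)
    qed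
  next
    case False
    then show ?thesis
      using x by (simp add: block2_def)
  qed
  then have "fst t *v x = mat 1 *v x"
    unfolding matrix_vector_mult_def by (simp only:)
  then show ?thesis
    by simp
qed

text \<open>Elements of \<open>T\<close> may still rotate the first block, but they fix their own
  translation part, so powers merely scale it.\<close>

lemma snd_epow:
  assumes "fst t *v snd t = snd t"
  shows "snd (epow t k) = real k *\<^sub>R snd t"
proof (induction k)
  case (Suc k)
  then show ?case
    using assms by (simp add: snd_emul matrix_vector_mult_scaleR algebra_simps)
qed simp

text \<open>Approximate \<open>snd g\<close> divided by \<open>N\<close> by a pure translation of
  \<open>S\<close> and lift that to \<open>T\<close>: dividing \<open>g\<close> by the
  \<open>N\<close>-th power of the lift brings it into a ball of radius \<open>N * D\<close>, which
  contains finitely many elements of \<open>G\<close> by discreteness.\<close>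

lemma finite_reps:
  fixes D2 :: "'n::finite set" and S G T :: "'n euc set"
  assumes S: "space_group D2 S"
    and G: "euclid_subgroup G" and G_disc: "discrete_set G"
    and G_block: "G \<subseteq> {g. block_form D2 g}"
    and T_sub: "T \<subseteq> G" and T_bij: "bij_betw (proj D2) T (trans_sub S)"
    and N: "N \<in> Mset G T" and C: "is_reps G (Tpow T N) C"
  shows "finite C"
proof -
  have N1: "N \<ge> 1" and H: "normal_subgroup (Tpow T N) G"
    using N by (auto simp: Mset_def)
  obtain D where D: "\<And>x. x \<in> block2 D2 \<Longrightarrow> \<exists>s\<in>trans_sub S. norm (x - snd s) \<le> D"
    using translations_relatively_dense[OF S] by blast
  define F where "F = {g\<in>G. norm (snd g) \<le> real N * D}"
  have "\<exists>f\<in>F. \<exists>t\<in>Tpow T N. g = emul f t" if g: "g \<in> G" for g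
  proof -
    have "snd g \<in> block2 D2"
      using G_block g by (auto simp: block_form_def block2_def)
    then have "(1 / real N) *\<^sub>R snd g \<in> block2 D2"
      by (simp add: block2_def)
    then obtain s where s: "s \<in> trans_sub S" "norm ((1 / real N) *\<^sub>R snd g - snd s) \<le> D"
      using D by blast
    have "s \<in> proj D2 ` T"
      using T_bij s(1) by (simp add: bij_betw_imp_surj_on)
    then obtain t0 where t0: "t0 \<in> T" "proj D2 t0 = s"
      by (elim imageE) simp
    define t where "t = epow t0 N"
    have t: "t \<in> Tpow T N" "t \<in> G"
      using t0 normal_subgroupD(2)[OF H] by (auto simp: Tpow_def t_def)
    have "block_form D2 t0"
      using G_block T_sub t0(1) by blast
    moreover have "fst (proj D2 t0) = mat 1"
      using s(1) t0(2) by (simp add: trans_sub_def)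
    moreover have "snd t0 \<in> block2 D2"
      using \<open>block_form D2 t0\<close> by (simp add: block_form_def block2_def)
    ultimately have "snd t = real N *\<^sub>R snd t0"
      unfolding t_def by (intro snd_epow block2_fixed)
    also have "snd t0 = snd s"
      using t0(2) by (auto simp: proj_def)
    finally have snd_t: "snd t = real N *\<^sub>R snd s" .
    have tE: "in_E t"
      using euclid_subgroupD(1)[OF G t(2)] .
    \<comment> \<open>Dividing from the left gives a translation part of length
      \<open>norm (snd g - snd t)\<close>; normality then moves \<open>t\<close> to the right, where
      cosets need it.\<close>
    define f where "f = emul (einv t) g"
    have fG: "f \<in> G"
      unfolding f_def by (intro euclid_subgroupD[OF G] t g)
    have "snd f = transpose (fst t) *v (snd g - snd t)"
      by (simp add: f_def snd_emul snd_einv matrix_vector_mult_diff_distrib)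
    then have "norm (snd f) = norm (snd g - snd t)"
      using tE by (simp add: orthogonal_matrix_norm in_E_def)
    also have "snd g - snd t = real N *\<^sub>R ((1 / real N) *\<^sub>R snd g - snd s)"
      using N1 by (simp add: snd_t algebra_simps)
    also have "norm \<dots> \<le> real N * D"
      using s(2) by (simp add: mult_left_mono)
    finally have "f \<in> F"
      using fG by (simp add: F_def)
    moreover have "g = emul t f"
      using tE by (simp add: f_def)
    ultimately show ?thesis
      using normal_subgroup_swap[OF H G t(1) fG] by auto
  qed
  moreover have "c \<in> G" if "c \<in> C" for c
    using C that by (auto simp: is_reps_def)
  ultimately have "\<exists>f\<in>F. \<exists>t\<in>Tpow T N. c = emul f t" if "c \<in> C" for c
    using that by blast
  then obtain \<pi> \<tau> where \<pi>: "\<And>c. c \<in> C \<Longrightarrow> \<pi> c \<in> F" "\<And>c. c \<in> C \<Longrightarrow> \<tau> c \<in> Tpow T N"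
    "\<And>c. c \<in> C \<Longrightarrow> c = emul (\<pi> c) (\<tau> c)"
    by metis
  note HS = normal_subgroupD(1)[OF H]
  have "inj_on \<pi> C"
  proof (rule inj_onI)
    fix c d assume cd: "c \<in> C" "d \<in> C" "\<pi> c = \<pi> d"
    define s where "s = emul (einv (\<tau> c)) (\<tau> d)"
    have s: "s \<in> Tpow T N"
      unfolding s_def by (intro euclid_subgroupD[OF HS] \<pi> cd)
    have "emul (emul (\<pi> c) (\<tau> c)) s = emul (\<pi> d) (\<tau> d)"
      using euclid_subgroupD(1)[OF HS \<pi>(2)[OF cd(1)]] cd(3) by (simp add: s_def emul_assoc)
    then have "d = emul c s"
      using \<pi>(3) cd by metis
    then show "c = d"
      using is_reps_unique[OF C HS cd(1,2) s] by simp
  qed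
  moreover have "finite F"
    unfolding F_def by (rule finite_discrete_ball[OF G G_disc])
  ultimately show ?thesis
    using \<pi>(1) by (meson finite_subset finite_imageD image_subsetI)
qed

section \<open>Comparison of the seminorms\<close>

text \<open>\<open>grad\<close> ignores its set argument, for which \<open>{}\<close> is a dummy.\<close>
definition grad_l2 :: "'n::finite euc set \<Rightarrow> ('n euc \<Rightarrow> real^'n) \<Rightarrow> 'n euc \<Rightarrow> real" where
  "grad_l2 C u h = L2_set (\<lambda>g. norm (grad {} u g h)) C"

lemma grad_cong: "grad R u g h = grad R' u g h"
  by (simp add: grad_def)

lemma grad_norm_eq:
  "grad_norm R C u = sqrt (1 / real (card C)) * L2_set (grad_l2 C u) R"
proof -
  have "(\<Sum>g\<in>C. \<Sum>h\<in>R. (norm (grad R u g h))\<^sup>2) = (\<Sum>h\<in>R. (grad_l2 C u h)\<^sup>2)"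
    unfolding grad_l2_def L2_set_def grad_cong[of R _ _ _ "{}"]
    by (subst sum.swap) (simp add: sum_nonneg)
  then show ?thesis
    by (simp add: grad_norm_def L2_set_def real_sqrt_divide)
qed

lemma rot_in_E: "in_E h \<Longrightarrow> orthogonal_matrix (rot h)"
  by (simp add: in_E_def rot_def)

lemma grad_eone: "grad R u g eone = 0"
  by (simp add: grad_def rot_def transpose_mat)

lemma grad_emul:
  "grad R u g (emul h k) = grad R u (emul g h) k + transpose (rot k) *v grad R u g h"
  by (simp add: grad_def rot_def emul_assoc matrix_transpose_mul matrix_vector_mult_diff_distrib
      matrix_vector_mul_assoc)

lemma grad_einv:
  assumes "in_E h"
  shows "grad R u g (einv h) = - (rot h *v grad R u (emul g (einv h)) h)"
  using assms rot_in_E[OF assms]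
  by (simp add: grad_def emul_assoc matrix_vector_mult_diff_distrib orthogonal_matrix_inverse)
    (simp add: rot_def)

text \<open>Periodicity concerns multiplication on the right, so \<open>t\<close> must first pass
  \<open>h\<close>; normality replaces it by another element of \<open>H\<close>.\<close>

lemma grad_periodic:
  assumes H: "normal_subgroup H G" and G: "euclid_subgroup G" and u: "periodic G H u"
    and "g \<in> G" "t \<in> H" "h \<in> G"
  shows "grad R u (emul g t) h = grad R u g h"
proof -
  obtain t' where t': "t' \<in> H" "emul t h = emul h t'"
    using normal_subgroup_swap[OF H G assms(5,6)] by blast
  have "u (emul (emul g t) h) = u (emul (emul g h) t')"
    by (simp add: emul_assoc t'(2))
  also have "\<dots> = u (emul g h)"
    using u t'(1) euclid_subgroupD(3)[OF G assms(4,6)] by (simp add: periodic_def)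
  finally show ?thesis
    using u assms(4,5) by (simp add: grad_def periodic_def)
qed

lemma grad_l2_shift:
  assumes H: "normal_subgroup H G" and G: "euclid_subgroup G" and u: "periodic G H u"
    and C: "is_reps G H C" "finite C" and "h \<in> G" "k \<in> G"
  shows "L2_set (\<lambda>g. norm (grad {} u (emul g k) h)) C = grad_l2 C u h"
  unfolding L2_set_def grad_l2_def
  using sum_reps_shift[OF H G C \<open>k \<in> G\<close>, of "\<lambda>g. (norm (grad {} u g h))\<^sup>2"]
    grad_periodic[OF H G u _ _ \<open>h \<in> G\<close>] by simp

text \<open>The set of all \<open>h\<close> satisfying the claim is a subgroup containing \<open>R\<close>.\<close>
lemma grad_l2_bound:
  assumes G: "euclid_subgroup G" and R: "finite R" "R \<subseteq> G" "generated R = G" and h: "h \<in> G"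
  shows "\<exists>K\<ge>0. \<forall>H C u. normal_subgroup H G \<and> is_reps G H C \<and> finite C \<and> periodic G H u \<longrightarrow>
    grad_l2 C u h \<le> K * L2_set (grad_l2 C u) R"
proof -
  define adm where "adm = (\<lambda>H C u. normal_subgroup H G \<and> is_reps G H C \<and> finite C \<and> periodic G H u)"
  \<comment> \<open>The constant is chosen before \<open>H\<close>, \<open>C\<close> and
    \<open>u\<close>, so one value serves all periods.\<close>
  define W where "W = {h\<in>G. \<exists>K\<ge>0. \<forall>H C u. adm H C u \<longrightarrow> grad_l2 C u h \<le> K * L2_set (grad_l2 C u) R}"
  have "R \<subseteq> W"
  proof
    fix h assume h: "h \<in> R"
    have "grad_l2 C u h \<le> 1 * L2_set (grad_l2 C u) R" for C u
      using member_le_L2_set[OF R(1) h, of "grad_l2 C u"] by simp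
    then show "h \<in> W"
      using h R(2) unfolding W_def by (intro CollectI conjI exI[of _ 1]) auto
  qed
  moreover have "euclid_subgroup W"
    unfolding euclid_subgroup_def
  proof (intro conjI ballI)
    show "W \<subseteq> {g. in_E g}"
      using euclid_subgroupD(1)[OF G] by (auto simp: W_def)
    have "grad_l2 C u eone \<le> 0 * L2_set (grad_l2 C u) R" for C u
      by (simp add: grad_l2_def grad_eone L2_set_def)
    then show "eone \<in> W"
      using euclid_subgroupD(2)[OF G] unfolding W_def by (intro CollectI conjI exI[of _ 0]) auto
  next
    fix h k assume "h \<in> W" "k \<in> W"
    then obtain K L where hk: "h \<in> G" "k \<in> G" and "K \<ge> 0" "L \<ge> 0"
      and K: "\<And>H C u. adm H C u \<Longrightarrow> grad_l2 C u h \<le> K * L2_set (grad_l2 C u) R"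
      and L: "\<And>H C u. adm H C u \<Longrightarrow> grad_l2 C u k \<le> L * L2_set (grad_l2 C u) R"
      unfolding W_def by blast
    have "grad_l2 C u (emul h k) \<le> (K + L) * L2_set (grad_l2 C u) R" if adm: "adm H C u" for H C u
    proof -
      have "orthogonal_matrix (rot k)"
        by (intro rot_in_E euclid_subgroupD(1)[OF G] hk)
      then have "norm (grad {} u g (emul h k)) \<le> norm (grad {} u (emul g h) k) + norm (grad {} u g h)" for g
        unfolding grad_emul by (metis norm_triangle_ineq orthogonal_matrix_norm(2))
      then have "grad_l2 C u (emul h k)
          \<le> L2_set (\<lambda>g. norm (grad {} u (emul g h) k) + norm (grad {} u g h)) C"
        unfolding grad_l2_def by (intro L2_set_mono) auto
      also have "\<dots> \<le> L2_set (\<lambda>g. norm (grad {} u (emul g h) k)) C + grad_l2 C u h"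
        unfolding grad_l2_def by (rule L2_set_triangle_ineq)
      also have "L2_set (\<lambda>g. norm (grad {} u (emul g h) k)) C = grad_l2 C u k"
        using adm hk G unfolding adm_def by (intro grad_l2_shift[where H = H and G = G]) auto
      finally show ?thesis
        using K[OF adm] L[OF adm] by (simp add: algebra_simps)
    qed
    then show "emul h k \<in> W"
      using \<open>K \<ge> 0\<close> \<open>L \<ge> 0\<close> euclid_subgroupD(3)[OF G hk] unfolding W_def
      by (intro CollectI conjI exI[of _ "K + L"]) auto
  next
    fix h assume "h \<in> W"
    then obtain K where h: "h \<in> G" and "K \<ge> 0"
      and K: "\<And>H C u. adm H C u \<Longrightarrow> grad_l2 C u h \<le> K * L2_set (grad_l2 C u) R"
      unfolding W_def by blast
    have hE: "in_E h"
      by (intro euclid_subgroupD(1)[OF G] h)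
    have hi: "einv h \<in> G"
      by (intro euclid_subgroupD(4)[OF G] h)
    have "grad_l2 C u (einv h) \<le> K * L2_set (grad_l2 C u) R" if adm: "adm H C u" for H C u
    proof -
      have "grad_l2 C u (einv h) = L2_set (\<lambda>g. norm (grad {} u (emul g (einv h)) h)) C"
        using rot_in_E[OF hE] by (simp add: grad_l2_def grad_einv[OF hE] orthogonal_matrix_norm)
      also have "\<dots> = grad_l2 C u h"
        using adm h hi G unfolding adm_def by (intro grad_l2_shift[where H = H and G = G]) auto
      finally show ?thesis
        using K[OF adm] by simp
    qed
    then show "einv h \<in> W"
      using \<open>K \<ge> 0\<close> hi unfolding W_def by (intro CollectI conjI exI[of _ K]) auto
  qed
  ultimately have "generated R \<subseteq> W"
    unfolding generated_def by blast
  then have "h \<in> W"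
    using h R(3) by blast
  then show ?thesis
    by (simp add: W_def adm_def)
qed

lemma grad_norm_bound:
  assumes G: "euclid_subgroup G" and R: "finite R" "R \<subseteq> G" "generated R = G"
    and R': "finite R'" "R' \<subseteq> G"
  shows "\<exists>K>0. \<forall>H C u. normal_subgroup H G \<and> is_reps G H C \<and> finite C \<and> periodic G H u \<longrightarrow>
    grad_norm R' C u \<le> K * grad_norm R C u"
proof -
  obtain \<kappa> where \<kappa>: "\<And>h. h \<in> G \<Longrightarrow> \<kappa> h \<ge> 0"
    "\<And>h H C u. h \<in> G \<Longrightarrow> normal_subgroup H G \<and> is_reps G H C \<and> finite C \<and> periodic G H u \<Longrightarrow>
      grad_l2 C u h \<le> \<kappa> h * L2_set (grad_l2 C u) R"
    using grad_l2_bound[OF G R] by metis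
  \<comment> \<open>The summand \<open>1\<close> keeps \<open>K\<close> positive even if every
    \<open>\<kappa>\<close> vanishes or \<open>R'\<close> is empty.\<close>
  define K where "K = 1 + sum \<kappa> R'"
  have "sum \<kappa> R' \<ge> 0"
    using \<kappa>(1) R'(2) by (intro sum_nonneg) auto
  have "grad_norm R' C u \<le> K * grad_norm R C u"
    if adm: "normal_subgroup H G \<and> is_reps G H C \<and> finite C \<and> periodic G H u" for H C u
  proof -
    have nonneg: "grad_l2 C u h \<ge> 0" for h
      by (simp add: grad_l2_def L2_set_nonneg)
    have "L2_set (grad_l2 C u) R' \<le> (\<Sum>h\<in>R'. grad_l2 C u h)"
      using nonneg by (intro L2_set_le_sum)
    also have "\<dots> \<le> (\<Sum>h\<in>R'. \<kappa> h * L2_set (grad_l2 C u) R)"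
      using \<kappa>(2)[OF _ adm] R'(2) by (intro sum_mono) auto
    also have "\<dots> \<le> K * L2_set (grad_l2 C u) R"
      using L2_set_nonneg[of "grad_l2 C u" R] by (simp add: K_def algebra_simps flip: sum_distrib_left sum_distrib_right)
    finally have "sqrt (1 / real (card C)) * L2_set (grad_l2 C u) R'
        \<le> sqrt (1 / real (card C)) * (K * L2_set (grad_l2 C u) R)"
      by (intro mult_left_mono) auto
    then show ?thesis
      by (simp add: grad_norm_eq mult_ac)
  qed
  then show ?thesis
    using \<open>sum \<kappa> R' \<ge> 0\<close> by (intro exI[of _ K]) (auto simp: K_def)
qed

text \<open>Vanishing on generators spreads to all of \<open>G\<close> by
  \<open>grad_l2_bound\<close>; the differences at a single representative \<open>c\<close> then
  determine \<open>u\<close> everywhere. The converse is a direct computation.\<close>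

lemma grad_norm_eq_0_iff:
  assumes G: "euclid_subgroup G" and R: "finite R" "R \<subseteq> G" "generated R = G"
    and H: "normal_subgroup H G" and C: "is_reps G H C" "finite C" and u: "periodic G H u"
  shows "grad_norm R C u = 0 \<longleftrightarrow> u \<in> U_trans G"
proof
  have CG: "C \<subseteq> G" and "C \<noteq> {}"
    using C(1) euclid_subgroupD(2)[OF G] by (auto simp: is_reps_def)
  {
    assume "grad_norm R C u = 0"
    then have "L2_set (grad_l2 C u) R = 0"
      using \<open>C \<noteq> {}\<close> C(2) by (simp add: grad_norm_eq)
    then have le: "grad_l2 C u h \<le> 0" if "h \<in> G" for h
      using grad_l2_bound[OF G R that] H C u by (metis mult_zero_right)
    then have l2: "grad_l2 C u h = 0" if "h \<in> G" for h
      using le[OF that] L2_set_nonneg[of "\<lambda>g. norm (grad {} u g h)" C]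
      unfolding grad_l2_def by linarith
    obtain c where c: "c \<in> C"
      using \<open>C \<noteq> {}\<close> by blast
    have cG: "c \<in> G" "in_E c"
      using c CG euclid_subgroupD(1)[OF G] by blast+
    have "rot g *v u g = rot c *v u c" if g: "g \<in> G" for g
    proof -
      define h where "h = emul (einv c) g"
      have h: "h \<in> G"
        unfolding h_def by (intro euclid_subgroupD[OF G] cG g)
      have g_eq: "g = emul c h"
        using cG by (simp add: h_def)
      have "grad {} u c h = 0"
        using l2[OF h] c C(2) by (simp add: grad_l2_def L2_set_eq_0_iff)
      then have "u g = transpose (rot h) *v u c"
        by (simp add: grad_def g_eq)
      then have "rot h *v u g = u c"
        using rot_in_E[OF euclid_subgroupD(1)[OF G h]] by (simp add: orthogonal_matrix_inverse)
      then show ?thesis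
        by (simp add: g_eq rot_def flip: matrix_vector_mul_assoc)
    qed
    then show "u \<in> U_trans G"
      by (auto simp: U_trans_def)
  next
    assume "u \<in> U_trans G"
    then obtain a where a: "\<And>g. g \<in> G \<Longrightarrow> rot g *v u g = a"
      by (auto simp: U_trans_def)
    have "grad R u g h = 0" if gh: "g \<in> C" "h \<in> R" for g h
    proof -
      have G': "g \<in> G" "h \<in> G"
        using gh CG R(2) by blast+
      have "rot g *v (rot h *v u (emul g h)) = rot g *v u g"
        using a[OF G'(1)] a[OF euclid_subgroupD(3)[OF G G']]
        by (simp add: rot_def matrix_vector_mul_assoc)
      then have "rot h *v u (emul g h) = u g"
        using rot_in_E[OF euclid_subgroupD(1)[OF G G'(1)]] by (metis orthogonal_matrix_inverse(2))
      then have "u (emul g h) = transpose (rot h) *v u g"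
        using rot_in_E[OF euclid_subgroupD(1)[OF G G'(2)]] by (metis orthogonal_matrix_inverse(2))
      then show ?thesis
        by (simp add: grad_def)
    qed
    then show "grad_norm R C u = 0"
      by (simp add: grad_norm_def)
  }
qed

theorem theorem4p5:
  fixes D2 :: "'n::finite set" and S G T R1 R2 :: "'n euc set"
  assumes S: "space_group D2 S"
    and G_sub: "euclid_subgroup G" and G_disc: "discrete_set G"
    and G_block: "G \<subseteq> {g. block_form D2 g}" and G_proj: "proj D2 ` G = S"
    and T_sub: "T \<subseteq> G" and T_bij: "bij_betw (proj D2) T (trans_sub S)"
    and R1: "finite R1" "R1 \<subseteq> G" "generated R1 = G"
    and R2: "finite R2" "R2 \<subseteq> G" "generated R2 = G"
  shows "(\<exists>c>0. \<exists>C>0. \<forall>u \<in> U_per G T.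
            grad_seminorm G T R2 u \<le> C * grad_seminorm G T R1 u \<and>
            grad_seminorm G T R1 u \<le> c * grad_seminorm G T R2 u)
       \<and> {u \<in> U_per G T. grad_seminorm G T R1 u = 0} = U_trans G \<inter> U_per G T
       \<and> {u \<in> U_per G T. grad_seminorm G T R2 u = 0} = U_trans G \<inter> U_per G T"
proof -
  \<comment> \<open>The choices of \<open>N\<close> and of the representatives depend on
    \<open>u\<close> but not on \<open>R\<close>, so the two seminorms of one \<open>u\<close> are
    compared over the same \<open>H\<close> and \<open>C\<close>; uniform constants take care of the
    dependence on \<open>u\<close>.\<close>
  have seminorm: "\<exists>H C. (normal_subgroup H G \<and> is_reps G H C \<and> finite C \<and> periodic G H u) \<and>
      (\<forall>R. grad_seminorm G T R u = grad_norm R C u)" if u: "u \<in> U_per G T" for u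
  proof -
    define N where "N = (SOME N. N \<in> Mset G T \<and> periodic G (Tpow T N) u)"
    have "\<exists>N. N \<in> Mset G T \<and> periodic G (Tpow T N) u"
      using u by (auto simp: U_per_def)
    then have N: "N \<in> Mset G T \<and> periodic G (Tpow T N) u"
      unfolding N_def by (rule someI_ex)
    then have H: "normal_subgroup (Tpow T N) G"
      by (simp add: Mset_def)
    then have "\<exists>C. is_reps G (Tpow T N) C"
      by (intro ex_reps G_sub) (auto simp: normal_subgroup_def)
    then have "is_reps G (Tpow T N) (C_reps G T N)"
      unfolding C_reps_def by (rule someI_ex)
    moreover from this have "finite (C_reps G T N)"
      using finite_reps[OF S G_sub G_disc G_block T_sub T_bij] N by blast
    ultimately show ?thesis
      using H N by (intro exI[of _ "Tpow T N"] exI[of _ "C_reps G T N"])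
        (simp add: grad_seminorm_def N_def)
  qed
  obtain K where "K > 0"
    and K: "\<And>H C u. normal_subgroup H G \<and> is_reps G H C \<and> finite C \<and> periodic G H u \<Longrightarrow>
      grad_norm R2 C u \<le> K * grad_norm R1 C u"
    using grad_norm_bound[OF G_sub R1 R2(1,2)] by blast
  obtain L where "L > 0"
    and L: "\<And>H C u. normal_subgroup H G \<and> is_reps G H C \<and> finite C \<and> periodic G H u \<Longrightarrow>
      grad_norm R1 C u \<le> L * grad_norm R2 C u"
    using grad_norm_bound[OF G_sub R2 R1(1,2)] by blast
  have equiv: "grad_seminorm G T R2 u \<le> K * grad_seminorm G T R1 u \<and>
      grad_seminorm G T R1 u \<le> L * grad_seminorm G T R2 u" if u: "u \<in> U_per G T" for u
  proof -
    obtain H C where HC: "normal_subgroup H G \<and> is_reps G H C \<and> finite C \<and> periodic G H u"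
      and eq: "\<And>R. grad_seminorm G T R u = grad_norm R C u"
      using seminorm[OF u] by (elim exE conjE) blast
    show ?thesis
      unfolding eq using K[OF HC] L[OF HC] ..
  qed
  have kernel: "{u \<in> U_per G T. grad_seminorm G T R u = 0} = U_trans G \<inter> U_per G T"
    if R: "finite R" "R \<subseteq> G" "generated R = G" for R
  proof -
    have "grad_seminorm G T R u = 0 \<longleftrightarrow> u \<in> U_trans G" if u: "u \<in> U_per G T" for u
    proof -
      obtain H C where HC: "normal_subgroup H G \<and> is_reps G H C \<and> finite C \<and> periodic G H u"
        and eq: "\<And>R. grad_seminorm G T R u = grad_norm R C u"
        using seminorm[OF u] by (elim exE conjE) blast
      show ?thesis
        unfolding eq by (rule grad_norm_eq_0_iff[OF G_sub R]) (use HC in auto)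
    qed
    then show ?thesis
      by blast
  qed
  show ?thesis
    using \<open>K > 0\<close> \<open>L > 0\<close> equiv kernel[OF R1] kernel[OF R2] by blast
qed

end
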